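(* Let $n,q\ge1$, let $0<\tau_1\le\dots\le\tau_q$, let $\hat J=-\hat J^\top\in\mathbb{R}^{n\times n}$, let $\hat R\in\mathbb{R}^{n\times n}$ be symmetric positive semi-definite, $\hat A:=\hat J-\hat R$, and $\hat Z_1,\dots,\hat Z_q\in\mathbb{R}^{n\times n}$. Consider the zero-input delay system $$\dot x(t)=\hat Ax(t)+\sum_{i=1}^q\hat Z_ix(t-\tau_i),\quad t\ge0,\qquad x(t)=\phi(t),\ t\in[-\tau_q,0].$$ Suppose there exist a symmetric positive definite matrix $\mathcal{P}\in\mathbb{R}^{n(q+1)\times n(q+1)}$ and symmetric positive semi-definite matrices $\Theta_i,\Gamma_i,\Omega_i\in\mathbb{R}^{n\times n}$ ($i=1,\dots,q$) such that $$2\,\mathrm{sym}(\hat G_2^\top\mathcal{P}\hat G_1)+\hat M_1+\hat M_{2,\tau}+\hat M_{3,\tau}+\hat M_4<0,$$ where, with block sizes $n,\ nq,\ nq$, and $\Gamma_{\Sigma,\tau}:=\sum_{i=1}^q\tau_i^2\Gamma_i$, $\Omega_{\Sigma,\tau}:=\sum_{i=1}^q\tau_i^2\Omega_i$, $\Gamma_{\Sigma,1}:=\sum_{i=1}^q\Gamma_i$, $\hat Z:=\begin{bmatrix}\hat Z_1&\cdots&\hat Z_q\end{bmatrix}$, $\Gamma_{\rm row}:=\begin{bmatrix}\Gamma_1&\cdots&\Gamma_q\end{bmatrix}$, $$\hat G_1=\begin{bmatrix}I_n&0&0\\0&0&\mathrm{diag}(\tau_iI_n)_{i=1}^q\end{bmatrix},\qquad\hat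 G_2=\begin{bmatrix}\hat A&\hat Z&0\\ \begin{bmatrix}I_n&\cdots&I_n\end{bmatrix}^\top&-I_{nq}&0\end{bmatrix},$$ $$\hat M_1=\begin{bmatrix}\sum_{i=1}^q\Theta_i&0&0\\0&-\mathrm{diag}(\Theta_i)_{i=1}^q&0\\0&0&0\end{bmatrix},\qquad \hat M_{2,\tau}=\begin{bmatrix}\hat A^\top\Gamma_{\Sigma,\tau}\hat A&\hat A^\top\Gamma_{\Sigma,\tau}\hat Z&0\\ *&\hat Z^\top\Gamma_{\Sigma,\tau}\hat Z&0\\0&0&-\mathrm{diag}(\tau_i^2\Omega_i)_{i=1}^q\end{bmatrix},$$ $$\hat M_{3,\tau}=\begin{bmatrix}-\Gamma_{\Sigma,1}+\Omega_{\Sigma,\tau}&\Gamma_{\rm row}&0\\ *&-\mathrm{diag}(\Gamma_i)_{i=1}^q&0\\0&0&0\end{bmatrix},\qquad \hat M_4=-3\begin{bmatrix}\Gamma_{\Sigma,1}&\Gamma_{\rm row}&-2\Gamma_{\rm row}\\ *&\mathrm{diag}(\Gamma_i)_{i=1}^q&-2\,\mathrm{diag}(\Gamma_i)_{i=1}^q\\ *&*&4\,\mathrm{diag}(\Gamma_i)_{i=1}^q\end{bmatrix}.$$ Then the system is globally exponentially stable for the delays $\tau_1,\dots,\tau_q$.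
   Context: Notation: $\mathrm{sym}(A)=\tfrac12(A+A^\top)$; $\mathrm{diag}(A_i)_{i=1}^q$ is the block-diagonal matrix with diagonal blocks $A_1,\dots,A_q$; $*$ in a symmetric block matrix denotes the transpose of the corresponding block above the diagonal; $M<0$ means $M$ is symmetric negative definite. The zero-input delay system is globally exponentially stable if there exist constants $b>0$ and $c\ge1$ such that for all initial histories $\phi\in C([-\tau_q,0],\mathbb{R}^n)$ the solution satisfies $\|x(t)\|\le ce^{-bt}\|\phi\|_\infty$ for all $t\ge0$, where $\|\phi\|_\infty=\sup_{s\in[-\tau_q,0]}\|\phi(s)\|$ and $\|\cdot\|$ is the Euclidean norm. *)

theory Defs
  imports "HOL-Analysis.Analysis"
begin

section \<open>Definite matrices\<close>

definition pos_def :: "real^'m^'m \<Rightarrow> bool" where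
  "pos_def M \<longleftrightarrow> transpose M = M \<and> (\<forall>v. v \<noteq> 0 \<longrightarrow> v \<bullet> (M *v v) > 0)"

definition pos_semidef :: "real^'m^'m \<Rightarrow> bool" where
  "pos_semidef M \<longleftrightarrow> transpose M = M \<and> (\<forall>v. v \<bullet> (M *v v) \<ge> 0)"

definition neg_def :: "real^'m^'m \<Rightarrow> bool" where
  "neg_def M \<longleftrightarrow> transpose M = M \<and> (\<forall>v. v \<noteq> 0 \<longrightarrow> v \<bullet> (M *v v) < 0)"

definition sym_part :: "real^'m^'m \<Rightarrow> real^'m^'m" where
  "sym_part M = (1/2) *\<^sub>R (M + transpose M)"

section \<open>Block matrices\<close>

text \<open>
  The dimension \<open>n\<close> is the cardinality of the index type \<open>'n\<close>, and the delays are
  indexed by a finite linear order \<open>'q\<close>, which stands for \<open>{1, \<dots>, q}\<close>.  A vector made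
  of \<open>q\<close> blocks of size \<open>n\<close> is indexed by \<open>'q \<times> 'n\<close> (block number first), and
  juxtaposed blocks are indexed by sum types, so vectors with \<open>n(q+1)\<close> entries have type
  \<open>real^('n + 'q \<times> 'n)\<close>.
\<close>

definition hcat :: "real^'a^'m \<Rightarrow> real^'b^'m \<Rightarrow> real^('a + 'b)^'m"  (infixr "|||" 60) where
  "A ||| B = (\<chi> i j. case j of Inl a \<Rightarrow> A $ i $ a | Inr b \<Rightarrow> B $ i $ b)"

definition vcat :: "real^'m^'a \<Rightarrow> real^'m^'b \<Rightarrow> real^'m^('a + 'b)"  (infixr "===" 55) where
  "A === B = (\<chi> i. case i of Inl a \<Rightarrow> A $ a | Inr b \<Rightarrow> B $ b)"

definition block_row :: "('q::finite \<Rightarrow> real^'n^'m) \<Rightarrow> real^('q \<times> 'n)^'m" where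
  "block_row B = (\<chi> i j. B (fst j) $ i $ snd j)"

definition block_diag :: "('q::finite \<Rightarrow> real^'n^'n) \<Rightarrow> real^('q \<times> 'n)^('q \<times> 'n)" where
  "block_diag B = (\<chi> i j. if fst i = fst j then B (fst i) $ snd i $ snd j else 0)"

section \<open>The delay system\<close>

definition max_delay :: "('q::{finite,linorder} \<Rightarrow> real) \<Rightarrow> real" where
  "max_delay \<tau> = \<tau> (Max UNIV)"

text \<open>
  The one-sided derivative at \<open>0\<close> is meant by \<open>at t within {0..}\<close>.  Continuity of \<open>x\<close>
  on \<open>{- max_delay \<tau>..}\<close> follows from continuity of \<open>\<phi>\<close>; the values of \<open>x\<close> to the left
  of this interval are irrelevant.
\<close>

definition delay_solution ::
  "real^'n^'n \<Rightarrow> ('q::{finite,linorder} \<Rightarrow> real^'n^'n) \<Rightarrow> ('q \<Rightarrow> real)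
    \<Rightarrow> (real \<Rightarrow> real^'n) \<Rightarrow> (real \<Rightarrow> real^'n) \<Rightarrow> bool" where
  "delay_solution A Z \<tau> \<phi> x \<longleftrightarrow>
     (\<forall>t\<in>{- max_delay \<tau>..0}. x t = \<phi> t) \<and>
     (\<forall>t\<ge>0. (x has_vector_derivative (A *v x t + (\<Sum>i\<in>UNIV. Z i *v x (t - \<tau> i))))
               (at t within {0..}))"

definition globally_exp_stable ::
  "real^'n^'n \<Rightarrow> ('q::{finite,linorder} \<Rightarrow> real^'n^'n) \<Rightarrow> ('q \<Rightarrow> real) \<Rightarrow> bool" where
  "globally_exp_stable A Z \<tau> \<longleftrightarrow>
     (\<exists>b>0. \<exists>c\<ge>1. \<forall>\<phi> x.
        continuous_on {- max_delay \<tau>..0} \<phi> \<longrightarrow> delay_solution A Z \<tau> \<phi> x \<longrightarrow>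
        (\<forall>t\<ge>0. norm (x t) \<le> c * exp (- b * t) * (SUP s\<in>{- max_delay \<tau>..0}. norm (\<phi> s))))"

section \<open>The matrices of the linear matrix inequality\<close>

definition G1 :: "('q::finite \<Rightarrow> real) \<Rightarrow> real^('n::finite + 'q \<times> 'n + 'q \<times> 'n)^('n + 'q \<times> 'n)" where
  "G1 \<tau> = (mat 1 ||| 0 ||| 0)
      === (0     ||| 0 ||| block_diag (\<lambda>i. \<tau> i *\<^sub>R mat 1))"

definition G2 :: "real^'n^'n \<Rightarrow> ('q::finite \<Rightarrow> real^'n^'n)
    \<Rightarrow> real^('n + 'q \<times> 'n + 'q \<times> 'n)^('n + 'q \<times> 'n)" where
  "G2 A Z = (A                                ||| block_row Z ||| 0)
        === (transpose (block_row (\<lambda>_. mat 1)) ||| - mat 1     ||| 0)"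

definition M1 :: "('q::finite \<Rightarrow> real^'n^'n)
    \<Rightarrow> real^('n + 'q \<times> 'n + 'q \<times> 'n)^('n + 'q \<times> 'n + 'q \<times> 'n)" where
  "M1 \<Theta> = ((\<Sum>i\<in>UNIV. \<Theta> i) ||| 0              ||| 0)
      === (0              ||| - block_diag \<Theta> ||| 0)
      === (0              ||| 0              ||| 0)"

definition M2 :: "real^'n^'n \<Rightarrow> ('q::finite \<Rightarrow> real^'n^'n) \<Rightarrow> ('q \<Rightarrow> real)
    \<Rightarrow> ('q \<Rightarrow> real^'n^'n) \<Rightarrow> ('q \<Rightarrow> real^'n^'n)
    \<Rightarrow> real^('n + 'q \<times> 'n + 'q \<times> 'n)^('n + 'q \<times> 'n + 'q \<times> 'n)" where
  "M2 A Z \<tau> \<Gamma> \<Omega> =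
    (let \<Gamma>\<tau> = (\<Sum>i\<in>UNIV. (\<tau> i)\<^sup>2 *\<^sub>R \<Gamma> i);
         Zr = block_row Z
     in (transpose A ** \<Gamma>\<tau> ** A              ||| transpose A ** \<Gamma>\<tau> ** Zr  ||| 0)
    === (transpose (transpose A ** \<Gamma>\<tau> ** Zr) ||| transpose Zr ** \<Gamma>\<tau> ** Zr ||| 0)
    === (0 ||| 0 ||| - block_diag (\<lambda>i. (\<tau> i)\<^sup>2 *\<^sub>R \<Omega> i)))"

definition M3 :: "('q::finite \<Rightarrow> real) \<Rightarrow> ('q \<Rightarrow> real^'n^'n) \<Rightarrow> ('q \<Rightarrow> real^'n^'n)
    \<Rightarrow> real^('n + 'q \<times> 'n + 'q \<times> 'n)^('n + 'q \<times> 'n + 'q \<times> 'n)" where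
  "M3 \<tau> \<Gamma> \<Omega> =
        (- (\<Sum>i\<in>UNIV. \<Gamma> i) + (\<Sum>i\<in>UNIV. (\<tau> i)\<^sup>2 *\<^sub>R \<Omega> i) ||| block_row \<Gamma>    ||| 0)
    === (transpose (block_row \<Gamma>)                        ||| - block_diag \<Gamma> ||| 0)
    === (0                                              ||| 0              ||| 0)"

definition M4 :: "('q::finite \<Rightarrow> real^'n^'n)
    \<Rightarrow> real^('n + 'q \<times> 'n + 'q \<times> 'n)^('n + 'q \<times> 'n + 'q \<times> 'n)" where
  "M4 \<Gamma> =
    (let \<Gamma>r = block_row \<Gamma>; \<Gamma>d = block_diag \<Gamma>
     in (-3) *\<^sub>R
       (((\<Sum>i\<in>UNIV. \<Gamma> i)          ||| \<Gamma>r                      ||| (-2) *\<^sub>R \<Gamma>r)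
    === (transpose \<Gamma>r             ||| \<Gamma>d                      ||| (-2) *\<^sub>R \<Gamma>d)
    === (transpose ((-2) *\<^sub>R \<Gamma>r) ||| transpose ((-2) *\<^sub>R \<Gamma>d) ||| 4 *\<^sub>R \<Gamma>d)))"

end

theory Submission
  imports Defs
begin

text \<open>
  The proof uses a Lyapunov--Krasovskii functional.  With \<open>z = (x(t), \<integral>\<^bsub>t-\<tau>\<^sub>i\<^esub>\<^bsup>t\<^esup> x)\<close>
  take \<open>V = z\<^sup>T P z + \<Sum>\<^sub>i (\<integral> x\<^sup>T \<Theta>\<^sub>i x + \<tau>\<^sub>i \<integral> (s - t + \<tau>\<^sub>i) (x'\<^sup>T \<Gamma>\<^sub>i x' + x\<^sup>T \<Omega>\<^sub>i x) ds)\<close>,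
  all integrals being over \<open>[t - \<tau>\<^sub>i, t]\<close>.  Jensen's inequality for the \<open>\<Omega>\<close>-terms and the Wirtinger-based
  inequality for the \<open>\<Gamma>\<close>-terms bound \<open>V'\<close> by the quadratic form of the matrix inequality at
  \<open>\<xi> = (x(t), x(t - \<tau>\<^sub>i), mean of x over [t - \<tau>\<^sub>i, t])\<close>, hence \<open>V' \<le> - \<epsilon> \<eta>\<close> with
  \<open>\<eta>(t) = |x(t)|\<^sup>2 + \<Sum>\<^sub>i |x(t - \<tau>\<^sub>i)|\<^sup>2\<close>.  As \<open>V\<close> also contains integrals of \<open>\<eta>\<close>, it is no match for
  \<open>\<eta>(t)\<close> alone; adding a small multiple of \<open>\<integral> (s - t + h) \<eta>(s) ds\<close> over \<open>[t - h, t]\<close>, where \<open>h\<close>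
  is the largest delay, gives \<open>W\<close> with \<open>W' \<le> - 2 b W\<close>.  Because the history is merely continuous, \<open>V\<close> makes
  sense only once a full delay has passed; until time \<open>3 h\<close> a Gronwall-type bound is used instead.
\<close>

section \<open>Quadratic forms of block matrices\<close>

text \<open>As a simp rule it would turn \<open>transpose M *v u\<close> into \<open>u v* M\<close>,
  whereas all block computations below are phrased with \<open>*v\<close>.\<close>

declare transpose_matrix_vector [simp del]

definition qform :: "real^'m^'m \<Rightarrow> real^'m \<Rightarrow> real" where
  "qform M v = v \<bullet> (M *v v)"

definition vjoin :: "real^'a \<Rightarrow> real^'b \<Rightarrow> real^('a::finite + 'b::finite)" where
  "vjoin u v = (\<chi> i. case i of Inl a \<Rightarrow> u $ a | Inr b \<Rightarrow> v $ b)"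

definition vflat :: "('q::finite \<Rightarrow> real^'n) \<Rightarrow> real^('q \<times> 'n::finite)" where
  "vflat y = (\<chi> i. y (fst i) $ snd i)"

lemma sum_Plus_UNIV:
  fixes f :: "'a::finite + 'b::finite \<Rightarrow> 'c::comm_monoid_add"
  shows "sum f UNIV = (\<Sum>a\<in>UNIV. f (Inl a)) + (\<Sum>b\<in>UNIV. f (Inr b))"
  by (simp add: UNIV_sum sum.union_disjoint sum.reindex image_Int disjoint_iff)
     (subst sum.union_disjoint; auto simp: sum.reindex)

lemma sum_Times_UNIV:
  fixes f :: "'a::finite \<times> 'b::finite \<Rightarrow> 'c::comm_monoid_add"
  shows "sum f UNIV = (\<Sum>a\<in>UNIV. \<Sum>b\<in>UNIV. f (a, b))"
  by (simp add: sum.cartesian_product flip: UNIV_Times_UNIV)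

lemma hcat_mult_vjoin: "(A ||| B) *v vjoin u v = A *v u + B *v v"
  by (simp add: hcat_def vjoin_def matrix_vector_mult_def vec_eq_iff sum_Plus_UNIV)

lemma vcat_mult: "(A === B) *v w = vjoin (A *v w) (B *v w)"
  by (simp add: vcat_def vjoin_def matrix_vector_mult_def vec_eq_iff split: sum.split)

lemma inner_vjoin: "vjoin u v \<bullet> vjoin u' v' = u \<bullet> u' + v \<bullet> v'"
  by (simp add: inner_vec_def vjoin_def sum_Plus_UNIV)

lemma inner_vflat: "vflat y \<bullet> vflat y' = (\<Sum>i\<in>UNIV. y i \<bullet> y' i)"
  by (simp add: inner_vec_def vflat_def sum_Times_UNIV)

lemma vflat_diff: "vflat y - vflat y' = vflat (\<lambda>i. y i - y' i)"
  by (simp add: vflat_def vec_eq_iff)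

lemma block_row_mult_vflat: "block_row B *v vflat y = (\<Sum>i\<in>UNIV. B i *v y i)"
  by (simp add: block_row_def vflat_def matrix_vector_mult_def vec_eq_iff sum_Times_UNIV)

lemma transpose_block_row_mult: "transpose (block_row B) *v u = vflat (\<lambda>i. transpose (B i) *v u)"
  by (simp add: block_row_def vflat_def matrix_vector_mult_def transpose_def vec_eq_iff)

lemma block_diag_mult_vflat: "block_diag B *v vflat y = vflat (\<lambda>i. B i *v y i)"
proof -
  have "(\<Sum>a\<in>UNIV. \<Sum>b\<in>UNIV. (if i = a then B i $ k $ b else 0) * y a $ b)
      = (\<Sum>b\<in>UNIV. B i $ k $ b * y i $ b)" for i k
    by (simp add: if_distrib[of "\<lambda>c. c * _"] sum.If_cases[symmetric] sum.swap[of _ UNIV UNIV] cong: if_cong)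
  then show ?thesis
    by (simp add: block_diag_def vflat_def matrix_vector_mult_def vec_eq_iff sum_Times_UNIV cong: if_cong)
qed

lemma transpose_block_diag: "transpose (block_diag B) = block_diag (\<lambda>i. transpose (B i))"
  by (simp add: block_diag_def transpose_def vec_eq_iff)

lemma transpose_scaleR_mult: "transpose (c *\<^sub>R M) *v u = c *\<^sub>R (transpose M *v u)" for M :: "real^'a^'b"
  by (simp add: transpose_def matrix_vector_mult_def vec_eq_iff sum_distrib_left mult_ac)

lemma scaleR_matrix_mult: "(c *\<^sub>R M) *v u = c *\<^sub>R (M *v u)" for M :: "real^'a^'b"
  by (simp add: matrix_vector_mult_def vec_eq_iff sum_distrib_left mult_ac)

lemma minus_matrix_mult: "(- M) *v u = - (M *v u)" for M :: "real^'a^'b"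
  by (simp add: matrix_vector_mult_def vec_eq_iff sum_negf)

lemma transpose_minus_mult: "transpose (- M) *v u = - (transpose M *v u)" for M :: "real^'a^'b"
  by (simp add: transpose_def matrix_vector_mult_def vec_eq_iff sum_negf)

lemma sum_matrix_mult: "(\<Sum>i\<in>I. M i) *v u = (\<Sum>i\<in>I. M i *v u)" for M :: "'q \<Rightarrow> real^'a^'b"
  by (induction I rule: infinite_finite_induct) (simp_all add: matrix_vector_mult_add_rdistrib)

lemma qform_add: "qform (M + N) v = qform M v + qform N v"
  by (simp add: qform_def matrix_vector_mult_add_rdistrib inner_add_right)

lemma inner_matrix_mult: "v \<bullet> (M *v u) = (transpose M *v v) \<bullet> u" for M :: "real^'a^'b"
  by (metis dot_lmul_matrix transpose_matrix_vector)

text \<open>A matrix and its transpose have the same quadratic form, so symmetrising changes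
  nothing. With \<open>M = G1 \<tau>\<close> and \<open>N = G2 A Z\<close> the right-hand side is
  the derivative of z^T P z, because these matrices send \<xi> to z and to z'.\<close>

lemma qform_sym_part: "qform (2 *\<^sub>R sym_part (transpose N ** P ** M)) v = 2 * ((N *v v) \<bullet> (P *v (M *v v)))"
proof -
  have "v \<bullet> (transpose M *v v) = v \<bullet> (M *v v)" for M :: "real^'a^'a"
    by (metis inner_matrix_mult inner_commute transpose_transpose)
  then show ?thesis
    by (simp add: qform_def sym_part_def scaleR_matrix_mult matrix_vector_mult_add_rdistrib inner_add_right
        inner_matrix_mult[of v "transpose N"] flip: matrix_vector_mul_assoc)
qed

text \<open>The third block of \<xi> holds means over the windows. Multiplying a mean by its delay
  turns it back into an integral, so \<open>G1\<close> recovers z; the next lemma does the same for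
  z' and \<open>G2\<close>.\<close>

lemma G1_mult: "G1 \<tau> *v vjoin x (vjoin (vflat y) (vflat w)) = vjoin x (vflat (\<lambda>i. \<tau> i *\<^sub>R w i))"
  by (simp add: G1_def vcat_mult hcat_mult_vjoin block_diag_mult_vflat scaleR_matrix_mult)

lemma G2_mult: "G2 A Z *v vjoin x (vjoin (vflat y) (vflat w))
    = vjoin (A *v x + (\<Sum>i\<in>UNIV. Z i *v y i)) (vflat (\<lambda>i. x - y i))"
  by (simp add: G2_def vcat_mult hcat_mult_vjoin block_row_mult_vflat transpose_block_row_mult
      minus_matrix_mult vflat_diff transpose_mat)

text \<open>This lemma and the next three evaluate the summands of the matrix inequality at \<xi> as
  sums over the delays, so that the integral inequalities can later be applied to one delay at a
  time.\<close>

lemma qform_M1: "qform (M1 \<Theta>) (vjoin x (vjoin (vflat y) (vflat w)))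
    = (\<Sum>i\<in>UNIV. qform (\<Theta> i) x - qform (\<Theta> i) (y i))"
  by (simp add: qform_def M1_def vcat_mult hcat_mult_vjoin block_diag_mult_vflat minus_matrix_mult
      inner_vjoin inner_vflat sum_matrix_mult inner_sum_right sum_subtractf)

lemma qform_M2:
  assumes "\<And>i. transpose (\<Gamma> i) = \<Gamma> i"
  shows "qform (M2 A Z \<tau> \<Gamma> \<Omega>) (vjoin x (vjoin (vflat y) (vflat w)))
    = (\<Sum>i\<in>UNIV. (\<tau> i)\<^sup>2 * qform (\<Gamma> i) (A *v x + (\<Sum>i\<in>UNIV. Z i *v y i)) - (\<tau> i)\<^sup>2 * qform (\<Omega> i) (w i))"
proof -
  \<comment> \<open>The \<Gamma>-part of \<open>M2\<close> sees the first two blocks only through x'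
    = A x + \<Sum> Z_i y_i, so its four blocks collapse to one quadratic form in that
    vector.\<close>
  define S where "S = (\<Sum>i\<in>UNIV. (\<tau> i)\<^sup>2 *\<^sub>R \<Gamma> i)"
  have S: "transpose S = S"
    using assms by (simp add: S_def vec_eq_iff transpose_def)
  have "qform (M2 A Z \<tau> \<Gamma> \<Omega>) (vjoin x (vjoin (vflat y) (vflat w)))
      = qform S (A *v x + (\<Sum>i\<in>UNIV. Z i *v y i)) - (\<Sum>i\<in>UNIV. (\<tau> i)\<^sup>2 * qform (\<Omega> i) (w i))"
    unfolding M2_def Let_def S_def[symmetric]
    by (simp add: qform_def vcat_mult hcat_mult_vjoin block_diag_mult_vflat minus_matrix_mult
      inner_vjoin inner_vflat scaleR_matrix_mult inner_add_left inner_add_right matrix_vector_right_distrib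
      matrix_transpose_mul S inner_matrix_mult[of _ "transpose A"] inner_matrix_mult[of _ "transpose (block_row Z)"]
      block_row_mult_vflat flip: matrix_vector_mul_assoc)
  also have "qform S v = (\<Sum>i\<in>UNIV. (\<tau> i)\<^sup>2 * qform (\<Gamma> i) v)" for v
    by (simp add: qform_def S_def sum_matrix_mult inner_sum_right scaleR_matrix_mult)
  finally show ?thesis by (simp add: sum_subtractf)
qed

lemma qform_M3:
  assumes "\<And>i. transpose (\<Gamma> i) = \<Gamma> i"
  shows "qform (M3 \<tau> \<Gamma> \<Omega>) (vjoin x (vjoin (vflat y) (vflat w)))
    = (\<Sum>i\<in>UNIV. (\<tau> i)\<^sup>2 * qform (\<Omega> i) x - qform (\<Gamma> i) (x - y i))"
proof -
  have "y i \<bullet> (\<Gamma> i *v x) = x \<bullet> (\<Gamma> i *v y i)" for i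
    by (metis assms inner_matrix_mult inner_commute)
  then show ?thesis
    by (simp add: qform_def sum_distrib_left matrix_vector_mult_diff_rdistrib
      M3_def vcat_mult hcat_mult_vjoin block_diag_mult_vflat minus_matrix_mult
      block_row_mult_vflat transpose_block_row_mult matrix_vector_mult_add_rdistrib matrix_vector_mult_diff_distrib
      inner_vjoin inner_vflat sum_matrix_mult inner_sum_right sum_subtractf sum.distrib scaleR_matrix_mult
      assms inner_diff_right inner_diff_left inner_add_right)
qed

text \<open>The block pattern with entries 1, 1, -2, -2, 4 is the expansion of a square. Its
  argument is the second term in the Wirtinger-based inequality.\<close>

lemma qform_M4:
  assumes "\<And>i. transpose (\<Gamma> i) = \<Gamma> i"
  shows "qform (M4 \<Gamma>) (vjoin x (vjoin (vflat y) (vflat w)))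
    = (\<Sum>i\<in>UNIV. - 3 * qform (\<Gamma> i) (x + y i - 2 *\<^sub>R w i))"
proof -
  have c: "y i \<bullet> (\<Gamma> i *v x) = x \<bullet> (\<Gamma> i *v y i)" "w i \<bullet> (\<Gamma> i *v x) = x \<bullet> (\<Gamma> i *v w i)"
     "w i \<bullet> (\<Gamma> i *v y i) = y i \<bullet> (\<Gamma> i *v w i)" for i
    by (metis assms inner_matrix_mult inner_commute)+
  show ?thesis
    by (simp add: qform_def M4_def Let_def vcat_mult hcat_mult_vjoin block_diag_mult_vflat minus_matrix_mult
      block_row_mult_vflat transpose_block_row_mult matrix_vector_mult_add_rdistrib matrix_vector_mult_diff_distrib
      inner_vjoin inner_vflat sum_matrix_mult inner_sum_right sum_subtractf sum.distrib scaleR_matrix_mult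
      assms inner_diff_right inner_diff_left inner_add_right inner_add_left matrix_vector_right_distrib
      transpose_scaleR_mult transpose_minus_mult transpose_block_diag c
      matrix_vector_mult_scaleR sum_distrib_left sum_negf algebra_simps)
qed

section \<open>Bounds on quadratic forms\<close>

lemma pos_semidef_qform: "pos_semidef M \<Longrightarrow> 0 \<le> qform M v"
  by (simp add: pos_semidef_def qform_def)

lemma qform_le: "\<exists>c>0. \<forall>v. qform M v \<le> c * (norm v)\<^sup>2"
proof -
  obtain c where "c > 0" and c: "\<And>v. norm (M *v v) \<le> norm v * c"
    using bounded_linear.pos_bounded[OF matrix_vector_mul_bounded_linear] by blast
  have "qform M v \<le> c * (norm v)\<^sup>2" for v
  proof -
    have "qform M v \<le> norm v * norm (M *v v)"
      unfolding qform_def by (rule norm_cauchy_schwarz)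
    also have "\<dots> \<le> norm v * (norm v * c)"
      by (intro mult_left_mono c) auto
    finally show ?thesis by (simp add: power2_eq_square mult_ac)
  qed
  with \<open>c > 0\<close> show ?thesis by blast
qed

lemma qform_scaleR: "qform M (r *\<^sub>R v) = r\<^sup>2 * qform M v"
  by (simp add: qform_def matrix_vector_mult_scaleR power2_eq_square)

text \<open>A positive quadratic form attains a positive minimum on the compact unit sphere, and
  homogeneity of degree two carries this bound to all vectors.\<close>

lemma qform_coercive:
  fixes M :: "real^'m^'m"
  assumes "\<And>v. v \<noteq> 0 \<Longrightarrow> 0 < qform M v"
  obtains e where "e > 0" "\<And>v. e * (norm v)\<^sup>2 \<le> qform M v"
proof -
  have "continuous_on (sphere 0 1) (qform M)"
    unfolding qform_def by (intro continuous_intros linear_continuous_on matrix_vector_mul_bounded_linear)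
  moreover have "sphere 0 1 \<noteq> ({} :: (real^'m) set)"
    by simp
  ultimately obtain u where u: "u \<in> sphere 0 1" "\<And>v. v \<in> sphere 0 1 \<Longrightarrow> qform M u \<le> qform M v"
    using continuous_attains_inf[OF compact_sphere] by blast
  show thesis
  proof
    show "qform M u > 0" using u(1) by (intro assms) auto
    fix v :: "real^'m"
    show "qform M u * (norm v)\<^sup>2 \<le> qform M v"
    proof (cases "v = 0")
      case False
      then have "qform M u \<le> qform M (inverse (norm v) *\<^sub>R v)"
        by (intro u(2)) simp
      with False show ?thesis by (simp add: qform_scaleR field_simps)
    qed (simp add: qform_def)
  qed
qed

section \<open>Integrals over a moving window\<close>

text \<open>With one fixed base point \<open>a\<close>, an integral over a moving window is a
  difference of two values of the same primitive, and its derivative in \<open>t\<close> comes from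
  the fundamental theorem alone.\<close>

definition prim :: "real \<Rightarrow> (real \<Rightarrow> 'a::banach) \<Rightarrow> real \<Rightarrow> 'a" where
  "prim a g t = integral {a..t} g"

definition win :: "real \<Rightarrow> real \<Rightarrow> (real \<Rightarrow> 'a::banach) \<Rightarrow> real \<Rightarrow> 'a" where
  "win \<tau> a g t = prim a g t - prim a g (t - \<tau>)"

text \<open>By parts, \<open>dwin \<tau> a g t\<close> is the weighted integral of \<open>(s - t + \<tau>) g(s)\<close> over \<open>[t - \<tau>, t]\<close>.\<close>

definition dwin :: "real \<Rightarrow> real \<Rightarrow> (real \<Rightarrow> real) \<Rightarrow> real \<Rightarrow> real" where
  "dwin \<tau> a g t = \<tau> * prim a g t - win \<tau> a (prim a g) t"

lemma prim_vector_derivative: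
  assumes "continuous_on {a..} g" "a < t"
  shows "(prim a g has_vector_derivative g t) (at t)"
proof -
  have "((\<lambda>u. integral {a..u} g) has_vector_derivative g t) (at t within {a..t+1})"
    using assms by (intro integral_has_vector_derivative continuous_on_subset[OF assms(1)]) auto
  moreover have "at t within {a..t+1} = at t"
    using assms(2) by (intro at_within_interior) auto
  ultimately show ?thesis by (simp add: prim_def[abs_def])
qed

lemmas prim_real_derivative =
  prim_vector_derivative[where 'a = real, folded has_real_derivative_iff_has_vector_derivative]

text \<open>\<open>dwin\<close> contains the primitive of \<open>prim a g\<close>; differentiating
  it requires that \<open>prim a g\<close> itself be continuous.\<close>

lemma continuous_on_prim:
  assumes "continuous_on {a..} g"
  shows "continuous_on {a..} (prim a g)"
  unfolding continuous_on_eq_continuous_within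
proof
  fix t assume t: "t \<in> {a..}"
  have "((\<lambda>u. integral {a..u} g) has_vector_derivative g t) (at t within {a..t+1})"
    using t by (intro integral_has_vector_derivative continuous_on_subset[OF assms]) auto
  then have "continuous (at t within {a..t+1}) (prim a g)"
    unfolding prim_def[abs_def] by (rule has_vector_derivative_continuous)
  moreover have "at t within {a..t+1} = at t within {a..}"
    by (rule at_within_nhd[where S = "{..<t+1}"]) auto
  ultimately show "continuous (at t within {a..}) (prim a g)" by simp
qed

lemma win_vector_derivative:
  assumes "continuous_on {a..} g" "0 \<le> \<tau>" "a < t - \<tau>"
  shows "(win \<tau> a g has_vector_derivative (g t - g (t - \<tau>))) (at t)"
proof -
  have "((\<lambda>t. prim a g (t - \<tau>)) has_vector_derivative g (t - \<tau>)) (at t)"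
    using vector_diff_chain_at[of "\<lambda>t. t - \<tau>" 1 t "prim a g" "g (t - \<tau>)"] prim_vector_derivative[OF assms(1,3)]
    by (simp add: o_def
        has_vector_derivative_diff[OF has_vector_derivative_id has_vector_derivative_const, simplified, unfolded id_def])
  then show ?thesis
    unfolding win_def[abs_def] using assms
    by (intro has_vector_derivative_diff prim_vector_derivative) auto
qed

lemmas win_real_derivative =
  win_vector_derivative[where 'a = real, folded has_real_derivative_iff_has_vector_derivative]

text \<open>The weight equals \<open>\<tau>\<close> at the right end of the window, vanishes at the
  left end, and decreases at unit rate in \<open>t\<close> in between.\<close>

lemma dwin_real_derivative:
  assumes "continuous_on {a..} g" "0 \<le> \<tau>" "a < t - \<tau>"
  shows "(dwin \<tau> a g has_real_derivative (\<tau> * g t - win \<tau> a g t)) (at t)"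
proof -
  have "((\<lambda>t. \<tau> * prim a g t - win \<tau> a (prim a g) t) has_real_derivative
      \<tau> * g t - (prim a g t - prim a g (t - \<tau>))) (at t)"
    using assms
    by (intro DERIV_diff DERIV_cmult prim_real_derivative win_real_derivative continuous_on_prim) auto
  then show ?thesis by (simp add: dwin_def[abs_def] win_def[of \<tau> a g])
qed

text \<open>Integral inequalities are obtained here by comparing antiderivatives:
  \<open>G - F\<close> is nondecreasing.\<close>

lemma diff_le_diff_of_deriv_le:
  fixes F G :: "real \<Rightarrow> real"
  assumes "r \<le> t"
    and "\<And>s. r \<le> s \<Longrightarrow> s \<le> t \<Longrightarrow> (F has_real_derivative F' s) (at s)"
    and "\<And>s. r \<le> s \<Longrightarrow> s \<le> t \<Longrightarrow> (G has_real_derivative G' s) (at s)"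
    and "\<And>s. r \<le> s \<Longrightarrow> s \<le> t \<Longrightarrow> F' s \<le> G' s"
  shows "F t - F r \<le> G t - G r"
proof -
  have "G r - F r \<le> G t - F t"
  proof (rule DERIV_nonneg_imp_nondecreasing[OF assms(1)])
    fix s assume "r \<le> s" "s \<le> t"
    then show "\<exists>y. ((\<lambda>s. G s - F s) has_real_derivative y) (at s) \<and> 0 \<le> y"
      using assms(2-4) by (intro exI[of _ "G' s - F' s"]) (auto intro!: derivative_eq_intros)
  qed
  then show ?thesis by simp
qed

lemma win_mono:
  fixes g :: "real \<Rightarrow> real"
  assumes "continuous_on {a..} g" "continuous_on {a..} k" "0 \<le> \<tau>" "a < t - \<tau>"
    and "\<And>s. a \<le> s \<Longrightarrow> s \<le> t \<Longrightarrow> g s \<le> k s"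
  shows "win \<tau> a g t \<le> win \<tau> a k t"
  unfolding win_def
  using assms by (intro diff_le_diff_of_deriv_le[where F' = g and G' = k] prim_real_derivative) auto

lemma win_cmult:
  fixes g :: "real \<Rightarrow> real"
  shows "win \<tau> a (\<lambda>s. c * g s) t = c * win \<tau> a g t"
  by (simp add: win_def prim_def right_diff_distrib)

lemma win_const:
  assumes "0 \<le> \<tau>" "a \<le> t - \<tau>"
  shows "win \<tau> a (\<lambda>_. c :: real) t = \<tau> * c"
  using assms by (simp add: win_def prim_def algebra_simps)

lemma win_nonneg:
  fixes g :: "real \<Rightarrow> real"
  assumes "continuous_on {a..} g" "0 \<le> \<tau>" "a < t - \<tau>" "\<And>s. a \<le> s \<Longrightarrow> 0 \<le> g s"
  shows "0 \<le> win \<tau> a g t"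
  using win_mono[of a "\<lambda>_. 0" g \<tau> t] assms by (simp add: win_const)

lemma win_mono_length:
  fixes g :: "real \<Rightarrow> real"
  assumes "continuous_on {a..} g" "0 \<le> \<tau>" "\<tau> \<le> h" "a < t - h" "\<And>s. a \<le> s \<Longrightarrow> 0 \<le> g s"
  shows "win \<tau> a g t \<le> win h a g t"
  \<comment> \<open>The surplus of the longer window is a window of length \<open>h - \<tau>\<close>
    ending at \<open>t - \<tau>\<close>.\<close>
  using win_nonneg[of a g "h - \<tau>" "t - \<tau>"] assms by (simp add: win_def)

text \<open>For nonnegative \<open>g\<close> the function \<open>prim a g\<close> is nondecreasing,
  so its integral over the window lies between \<open>\<tau>\<close> times its two end
  values.\<close>

lemma dwin_bounds:
  assumes "continuous_on {a..} g" "0 \<le> \<tau>" "a < t - \<tau>" "\<And>s. a \<le> s \<Longrightarrow> 0 \<le> g s"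
  shows "0 \<le> dwin \<tau> a g t" "dwin \<tau> a g t \<le> \<tau> * win \<tau> a g t"
proof -
  have G: "prim a g s \<le> prim a g r" if "t - \<tau> \<le> s" "s \<le> r" for s r
    using win_nonneg[of a g "r - s" r] assms that by (simp add: win_def)
  have PG: "(prim a (prim a g) has_real_derivative prim a g s) (at s)" if "t - \<tau> \<le> s" for s
    using assms that by (intro prim_real_derivative continuous_on_prim) auto
  have "prim a (prim a g) t - prim a (prim a g) (t - \<tau>) \<le> prim a g t * t - prim a g t * (t - \<tau>)"
    by (rule diff_le_diff_of_deriv_le[where F' = "prim a g" and G' = "\<lambda>_. prim a g t"])
       (use assms G PG in \<open>auto intro!: derivative_eq_intros\<close>)
  then show "0 \<le> dwin \<tau> a g t" by (simp add: dwin_def win_def algebra_simps)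
  have "prim a g (t - \<tau>) * t - prim a g (t - \<tau>) * (t - \<tau>) \<le> prim a (prim a g) t - prim a (prim a g) (t - \<tau>)"
    by (rule diff_le_diff_of_deriv_le[where G' = "prim a g" and F' = "\<lambda>_. prim a g (t - \<tau>)"])
       (use assms G PG in \<open>auto intro!: derivative_eq_intros\<close>)
  then show "dwin \<tau> a g t \<le> \<tau> * win \<tau> a g t" by (simp add: dwin_def win_def algebra_simps)
qed

section \<open>Calculus of quadratic forms and the two integral inequalities\<close>

lemma continuous_on_qform:
  "continuous_on S f \<Longrightarrow> continuous_on S (\<lambda>s. qform M (f s))"
  unfolding qform_def
  by (intro continuous_intros bounded_linear.continuous_on[OF matrix_vector_mul_bounded_linear])

lemma qform_real_derivative:
  assumes "transpose M = M" "(z has_vector_derivative z') (at t)"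
  shows "((\<lambda>t. qform M (z t)) has_real_derivative 2 * (z' \<bullet> (M *v z t))) (at t)"
proof -
  have "((\<lambda>t. z t \<bullet> (M *v z t)) has_vector_derivative z t \<bullet> (M *v z') + z' \<bullet> (M *v z t)) (at t)"
    by (rule bounded_bilinear.has_vector_derivative[OF bounded_bilinear_inner assms(2)
          bounded_linear.has_vector_derivative[OF matrix_vector_mul_bounded_linear assms(2)]])
  moreover have "z t \<bullet> (M *v z') = z' \<bullet> (M *v z t)"
    by (metis assms(1) inner_matrix_mult inner_commute)
  ultimately show ?thesis
    by (simp add: qform_def has_real_derivative_iff_has_vector_derivative)
qed

lemma inner_const_real_derivative:
  "(z has_vector_derivative z') (at t) \<Longrightarrow> ((\<lambda>t. z t \<bullet> c) has_real_derivative z' \<bullet> c) (at t)"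
  by (simp add: has_real_derivative_iff_has_vector_derivative bounded_linear.has_vector_derivative[OF bounded_linear_inner_left])

lemma qform_diff:
  assumes "transpose M = M"
  shows "qform M (u - v) = qform M u - 2 * (u \<bullet> (M *v v)) + qform M v"
proof -
  have "v \<bullet> (M *v u) = u \<bullet> (M *v v)"
    by (metis assms inner_matrix_mult inner_commute)
  then show ?thesis
    by (simp add: qform_def matrix_vector_mult_diff_distrib inner_diff_left inner_diff_right)
qed

text \<open>Jensen and Wirtinger both compare \<open>g\<close> with its best approximation \<open>c\<close> in a space of polynomials:
  \<open>qform M (g s - c s) \<ge> 0\<close> says that an explicit antiderivative is monotone.\<close>

lemma jensen_win:
  assumes M: "pos_semidef M" and g: "continuous_on {a..} g" and \<tau>: "0 < \<tau>" "a < t - \<tau>"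
  shows "qform M (win \<tau> a g t) \<le> \<tau> * win \<tau> a (\<lambda>s. qform M (g s)) t"
proof -
  define w where "w = win \<tau> a g t"
  \<comment> \<open>The best constant approximation of \<open>g\<close> on the window is its
    mean.\<close>
  define c where "c = (1 / \<tau>) *\<^sub>R w"
  have sym: "transpose M = M" using M by (simp add: pos_semidef_def)
  have "(2 * (prim a g t \<bullet> (M *v c)) - t * qform M c) - (2 * (prim a g (t - \<tau>) \<bullet> (M *v c)) - (t - \<tau>) * qform M c)
      \<le> prim a (\<lambda>s. qform M (g s)) t - prim a (\<lambda>s. qform M (g s)) (t - \<tau>)"
  proof (rule diff_le_diff_of_deriv_le[where F' = "\<lambda>s. 2 * (g s \<bullet> (M *v c)) - qform M c" and G' = "\<lambda>s. qform M (g s)"])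
    fix s assume s: "t - \<tau> \<le> s"
    show "2 * (g s \<bullet> (M *v c)) - qform M c \<le> qform M (g s)"
      using pos_semidef_qform[OF M, of "g s - c"] by (simp add: qform_diff sym)
    show "((\<lambda>s. 2 * (prim a g s \<bullet> (M *v c)) - s * qform M c) has_real_derivative 2 * (g s \<bullet> (M *v c)) - qform M c) (at s)"
      using \<tau> s g by (auto intro!: derivative_eq_intros inner_const_real_derivative prim_vector_derivative)
    show "(prim a (\<lambda>s. qform M (g s)) has_real_derivative qform M (g s)) (at s)"
      using \<tau> s g by (intro prim_real_derivative continuous_on_qform) auto
  qed (use \<tau> in auto)
  then have "2 * (w \<bullet> (M *v c)) - \<tau> * qform M c \<le> win \<tau> a (\<lambda>s. qform M (g s)) t"
    by (simp add: w_def win_def inner_diff_left algebra_simps)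
  moreover have "w \<bullet> (M *v c) = qform M w / \<tau>" "\<tau> * qform M c = qform M w / \<tau>"
    using \<tau> unfolding c_def by (simp_all add: qform_scaleR power2_eq_square) (simp add: qform_def matrix_vector_mult_scaleR)
  ultimately have "qform M w / \<tau> \<le> win \<tau> a (\<lambda>s. qform M (g s)) t" by simp
  with \<tau> show ?thesis by (simp add: w_def field_simps)
qed

lemma wirtinger_win:
  assumes M: "pos_semidef M" and x: "continuous_on {a..} x" and f: "continuous_on {a..} f"
    and x': "\<And>s. a < s \<Longrightarrow> (x has_vector_derivative f s) (at s)"
    and \<tau>: "0 < \<tau>" "a < t - \<tau>"
  shows "qform M (x t - x (t - \<tau>)) + 3 * qform M (x t + x (t - \<tau>) - (2 / \<tau>) *\<^sub>R win \<tau> a x t)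
    \<le> \<tau> * win \<tau> a (\<lambda>s. qform M (f s)) t"
proof -
  \<comment> \<open>The target is the best affine approximation of \<open>f\<close> on the window.
    \<open>D\<close> is the integral of \<open>f\<close>. \<open>p\<close> is the Legendre
    polynomial of degree one, running from -1 to 1, and by parts \<open>E\<close> is the integral of
    \<open>p\<close> times \<open>f\<close>. As the integral of \<open>p\<close> squared is
    \<open>\<tau> / 3\<close>, the approximation is
    \<open>D / \<tau> + (3 / \<tau>) p E\<close>.\<close>
  define D where "D = x t - x (t - \<tau>)"
  define E where "E = x t + x (t - \<tau>) - (2 / \<tau>) *\<^sub>R win \<tau> a x t"
  define p where "p s = (2 * s - 2 * t + \<tau>) / \<tau>" for s
  \<comment> \<open>\<open>Q\<close> is an antiderivative of twice the product of \<open>f\<close>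
    with that approximation, minus the quadratic form of the approximation. The term with
    \<open>prim a x\<close> comes from integrating \<open>p\<close> times \<open>f\<close> by
    parts.\<close>
  define Q where "Q s = 2 / \<tau> * (x s \<bullet> (M *v D))
      + 6 / \<tau> * (p s * (x s \<bullet> (M *v E)) - 2 / \<tau> * (prim a x s \<bullet> (M *v E)))
      - s / \<tau>\<^sup>2 * qform M D - 3 / (2 * \<tau>) * (p s)\<^sup>2 * (D \<bullet> (M *v E)) - 3 / (2 * \<tau>) * (p s)^3 * qform M E" for s
  have sym: "transpose M = M" using M by (simp add: pos_semidef_def)
  define Q' where "Q' s = 2 / \<tau> * (f s \<bullet> (M *v D)) + 6 / \<tau> * p s * (f s \<bullet> (M *v E))
      - 1 / \<tau>\<^sup>2 * qform M D - 6 / \<tau>\<^sup>2 * p s * (D \<bullet> (M *v E)) - 9 / \<tau>\<^sup>2 * (p s)\<^sup>2 * qform M E" for s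
  have sy: "E \<bullet> (M *v D) = D \<bullet> (M *v E)"
    by (metis sym inner_matrix_mult inner_commute)
  have "Q t - Q (t - \<tau>) \<le> prim a (\<lambda>s. qform M (f s)) t - prim a (\<lambda>s. qform M (f s)) (t - \<tau>)"
  proof (rule diff_le_diff_of_deriv_le[where F' = Q' and G' = "\<lambda>s. qform M (f s)"])
    fix s assume s: "t - \<tau> \<le> s"
    have "0 \<le> qform M (f s - ((1 / \<tau>) *\<^sub>R D + (3 / \<tau> * p s) *\<^sub>R E))"
      by (rule pos_semidef_qform[OF M])
    also have "\<dots> = qform M (f s) - Q' s"
      by (simp add: qform_diff sym Q'_def)
         (simp add: qform_def matrix_vector_mult_scaleR matrix_vector_right_distrib inner_add_left inner_add_right sy
           add_divide_distrib algebra_simps power2_eq_square)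
    finally show "Q' s \<le> qform M (f s)" by simp
    have p': "(p has_real_derivative 2 / \<tau>) (at s)"
      using \<tau> unfolding p_def[abs_def] by (auto intro!: derivative_eq_intros)
    have "a < s" using \<tau> s by simp
    note xd = inner_const_real_derivative[OF x'[OF this]]
      inner_const_real_derivative[OF prim_vector_derivative[OF x this]]
    show "(Q has_real_derivative Q' s) (at s)"
      unfolding Q_def[abs_def] Q'_def
      using \<tau> by (auto intro!: derivative_eq_intros xd p' simp: field_simps power2_eq_square power3_eq_cube)
    show "(prim a (\<lambda>s. qform M (f s)) has_real_derivative qform M (f s)) (at s)"
      using \<tau> s f by (intro prim_real_derivative continuous_on_qform) auto
  qed (use \<tau> in auto)
  \<comment> \<open>Between the ends of the window \<open>p\<close> squared does not change, so the
    mixed term in \<open>D\<close> and \<open>E\<close> drops out, while the cube of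
    \<open>p\<close> increases by 2.\<close>
  moreover have "Q t - Q (t - \<tau>) = 2 / \<tau> * qform M D + 6 / \<tau> * qform M E - 1 / \<tau> * qform M D - 3 / \<tau> * qform M E"
  proof -
    have p: "p t = 1" "p (t - \<tau>) = - 1" using \<tau> by (auto simp: p_def field_simps)
    have D: "qform M D = x t \<bullet> (M *v D) - x (t - \<tau>) \<bullet> (M *v D)"
      by (simp add: qform_def inner_diff_left flip: D_def) (simp add: D_def inner_diff_left)
    have E: "qform M E = x t \<bullet> (M *v E) + x (t - \<tau>) \<bullet> (M *v E)
        - 2 / \<tau> * (prim a x t \<bullet> (M *v E)) + 2 / \<tau> * (prim a x (t - \<tau>) \<bullet> (M *v E))"
    proof -
      have "qform M E = (x t + x (t - \<tau>) - (2 / \<tau>) *\<^sub>R win \<tau> a x t) \<bullet> (M *v E)"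
        by (simp add: qform_def E_def)
      then show ?thesis by (simp add: win_def inner_diff_left inner_add_left right_diff_distrib)
    qed
    show ?thesis
      unfolding Q_def p using \<tau> by (simp add: D E field_simps power2_eq_square)
  qed
  ultimately have "qform M D / \<tau> + 3 * qform M E / \<tau> \<le> win \<tau> a (\<lambda>s. qform M (f s)) t"
    by (simp add: win_def)
  with \<tau> show ?thesis by (simp add: D_def E_def field_simps)
qed

section \<open>Derivatives of stacked vectors\<close>

lemma has_vector_derivative_vec:
  "(z has_vector_derivative z') (at t) \<longleftrightarrow> (\<forall>i. ((\<lambda>s. z s $ i) has_vector_derivative z' $ i) (at t))"
  for z :: "real \<Rightarrow> real^'m"
  unfolding has_vector_derivative_def
  by (subst has_derivative_componentwise_within) (simp add: Basis_vec_def inner_axis)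

lemma vjoin_vector_derivative:
  assumes "(u has_vector_derivative u') (at t)" "(v has_vector_derivative v') (at t)"
  shows "((\<lambda>t. vjoin (u t) (v t)) has_vector_derivative vjoin u' v') (at t)"
  using assms by (simp add: has_vector_derivative_vec vjoin_def split: sum.split)

lemma vflat_vector_derivative:
  assumes "\<And>i. (u i has_vector_derivative u' i) (at t)"
  shows "((\<lambda>t. vflat (\<lambda>i. u i t)) has_vector_derivative vflat u') (at t)"
  using assms by (simp add: has_vector_derivative_vec vflat_def)

section \<open>The Lyapunov--Krasovskii functional\<close>

lemma qform_le_family:
  fixes M :: "'i::finite \<Rightarrow> real^'m^'m"
  shows "\<exists>c>0. \<forall>i v. qform (M i) v \<le> c * (norm v)\<^sup>2"
proof -
  obtain c where c: "\<And>i. c i > 0" "\<And>i v. qform (M i) v \<le> c i * (norm v)\<^sup>2"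
    using qform_le[of "M _"] by metis
  have "c i \<le> sum c UNIV" for i
    using c(1) by (intro member_le_sum) (auto intro: less_imp_le)
  then have "qform (M i) v \<le> sum c UNIV * (norm v)\<^sup>2" for i v
    by (meson c(2) mult_right_mono order_trans zero_le_power2)
  moreover have "sum c UNIV > 0"
    using c(1) by (intro sum_pos) auto
  ultimately show ?thesis by blast
qed

text \<open>\<open>f\<close> stands for the derivative of \<open>x\<close>, and \<open>a\<close> is
  the common base point of the primitives.\<close>

definition lyap :: "real^('n + 'q \<times> 'n)^('n + 'q \<times> 'n) \<Rightarrow> ('q::finite \<Rightarrow> real)
    \<Rightarrow> ('q \<Rightarrow> real^'n^'n) \<Rightarrow> ('q \<Rightarrow> real^'n^'n) \<Rightarrow> ('q \<Rightarrow> real^'n^'n) \<Rightarrow> real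
    \<Rightarrow> (real \<Rightarrow> real^'n) \<Rightarrow> (real \<Rightarrow> real^'n) \<Rightarrow> real \<Rightarrow> real" where
  "lyap P \<tau> \<Theta> \<Gamma> \<Omega> a x f t =
    qform P (vjoin (x t) (vflat (\<lambda>i. win (\<tau> i) a x t)))
    + (\<Sum>i\<in>UNIV. win (\<tau> i) a (\<lambda>s. qform (\<Theta> i) (x s)) t
        + \<tau> i * dwin (\<tau> i) a (\<lambda>s. qform (\<Gamma> i) (f s)) t
        + \<tau> i * dwin (\<tau> i) a (\<lambda>s. qform (\<Omega> i) (x s)) t)"

text \<open>The squared norm of this vector is \<eta>(t). It dominates x(t), and x'(t) is a fixed
  linear image of it.\<close>

definition hist :: "('q::finite \<Rightarrow> real) \<Rightarrow> (real \<Rightarrow> real^'n) \<Rightarrow> real \<Rightarrow> real^('n + 'q \<times> 'n)" where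
  "hist \<tau> x t = vjoin (x t) (vflat (\<lambda>i. x (t - \<tau> i)))"

lemma norm_hist: "(norm (hist \<tau> x t))\<^sup>2 = (norm (x t))\<^sup>2 + (\<Sum>i\<in>UNIV. (norm (x (t - \<tau> i)))\<^sup>2)"
  by (simp add: hist_def inner_vjoin inner_vflat flip: dot_square_norm)

text \<open>The part z^T P z contributes the summand with \<open>sym_part\<close>. Of the remaining
  terms, the boundary values are kept exactly and the integrals are estimated by Jensen and
  Wirtinger; together they give \<open>M1\<close> to \<open>M4\<close>. The norm comparison later
  turns negative definiteness in \<xi> into decay in terms of \<open>hist\<close>.\<close>

lemma lyap_derivative:
  fixes \<tau> :: "'q::finite \<Rightarrow> real" and x f :: "real \<Rightarrow> real^'n" and A :: "real^'n^'n"
  assumes x: "continuous_on {a..} x" and f: "continuous_on {a..} f"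
    and x': "\<And>s. a < s \<Longrightarrow> (x has_vector_derivative f s) (at s)"
    and \<tau>: "\<And>i. 0 < \<tau> i" "\<And>i. a < t - \<tau> i"
    and P: "transpose P = P" and \<Gamma>: "\<And>i. pos_semidef (\<Gamma> i)" and \<Omega>: "\<And>i. pos_semidef (\<Omega> i)"
    and ft: "f t = A *v x t + (\<Sum>i\<in>UNIV. Z i *v x (t - \<tau> i))"
  obtains D \<xi> where "(lyap P \<tau> \<Theta> \<Gamma> \<Omega> a x f has_real_derivative D) (at t)"
    "norm (hist \<tau> x t) \<le> norm \<xi>"
    "D \<le> qform (2 *\<^sub>R sym_part (transpose (G2 A Z) ** P ** G1 \<tau>)
            + M1 \<Theta> + M2 A Z \<tau> \<Gamma> \<Omega> + M3 \<tau> \<Gamma> \<Omega> + M4 \<Gamma>) \<xi>"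
proof
  define y where "y i = x (t - \<tau> i)" for i
  define w where "w i = (1 / \<tau> i) *\<^sub>R win (\<tau> i) a x t" for i
  define \<xi> where "\<xi> = vjoin (x t) (vjoin (vflat y) (vflat w))"
  define S where "S i = qform (\<Theta> i) (x t) - qform (\<Theta> i) (y i)
     + \<tau> i * (\<tau> i * qform (\<Gamma> i) (f t) - win (\<tau> i) a (\<lambda>s. qform (\<Gamma> i) (f s)) t)
     + \<tau> i * (\<tau> i * qform (\<Omega> i) (x t) - win (\<tau> i) a (\<lambda>s. qform (\<Omega> i) (x s)) t)" for i
  have \<Gamma>s: "transpose (\<Gamma> i) = \<Gamma> i" for i
    using \<Gamma> by (simp add: pos_semidef_def)
  \<comment> \<open>Index types are nonempty, so an arbitrary delay witnesses this.\<close>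
  have at: "a < t" using \<tau>[of undefined] by simp
  have tw: "(\<lambda>i. \<tau> i *\<^sub>R w i) = (\<lambda>i. win (\<tau> i) a x t)"
    using \<tau>(1) by (auto simp: w_def less_imp_neq[THEN not_sym])
  let ?z = "\<lambda>t. vjoin (x t) (vflat (\<lambda>i. win (\<tau> i) a x t))"
  let ?z' = "vjoin (f t) (vflat (\<lambda>i. x t - y i))"
  have "(?z has_vector_derivative ?z') (at t)"
    unfolding y_def using \<tau> x
    by (intro vjoin_vector_derivative vflat_vector_derivative x' at win_vector_derivative) (auto intro: less_imp_le)
  then have "((\<lambda>t. qform P (?z t)) has_real_derivative 2 * (?z' \<bullet> (P *v ?z t))) (at t)"
    by (rule qform_real_derivative[OF P])
  then show "(lyap P \<tau> \<Theta> \<Gamma> \<Omega> a x f has_real_derivative 2 * (?z' \<bullet> (P *v ?z t)) + (\<Sum>i\<in>UNIV. S i)) (at t)"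
    unfolding lyap_def[abs_def] S_def y_def using \<tau> x f
    by (intro DERIV_add DERIV_sum DERIV_cmult win_real_derivative dwin_real_derivative continuous_on_qform)
      (auto intro: less_imp_le)
  \<comment> \<open>The four brackets are the contributions of delay \<open>i\<close> to
    \<open>M1\<close>, \<open>M2\<close>, \<open>M3\<close> and \<open>M4\<close>.\<close>
  have "S i \<le> (qform (\<Theta> i) (x t) - qform (\<Theta> i) (y i))
      + ((\<tau> i)\<^sup>2 * qform (\<Gamma> i) (f t) - (\<tau> i)\<^sup>2 * qform (\<Omega> i) (w i))
      + ((\<tau> i)\<^sup>2 * qform (\<Omega> i) (x t) - qform (\<Gamma> i) (x t - y i))
      + (- 3 * qform (\<Gamma> i) (x t + y i - 2 *\<^sub>R w i))" for i
  proof -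
    have "(\<tau> i)\<^sup>2 * qform (\<Omega> i) (w i) \<le> \<tau> i * win (\<tau> i) a (\<lambda>s. qform (\<Omega> i) (x s)) t"
      using jensen_win[OF \<Omega> x \<tau>, of i i] unfolding qform_scaleR[symmetric] fun_cong[OF tw] .
    moreover have "qform (\<Gamma> i) (x t - y i) + 3 * qform (\<Gamma> i) (x t + y i - 2 *\<^sub>R w i)
        \<le> \<tau> i * win (\<tau> i) a (\<lambda>s. qform (\<Gamma> i) (f s)) t"
      using wirtinger_win[OF \<Gamma> x f x' \<tau>, of i i] by (simp add: y_def w_def)
    ultimately show ?thesis
      by (simp add: S_def power2_eq_square algebra_simps)
  qed
  then have "(\<Sum>i\<in>UNIV. S i) \<le> qform (M1 \<Theta>) \<xi> + qform (M2 A Z \<tau> \<Gamma> \<Omega>) \<xi> + qform (M3 \<tau> \<Gamma> \<Omega>) \<xi> + qform (M4 \<Gamma>) \<xi>"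
    unfolding \<xi>_def qform_M1 qform_M2[OF \<Gamma>s] qform_M3[OF \<Gamma>s] qform_M4[OF \<Gamma>s] sum.distrib[symmetric]
    by (intro sum_mono) (simp add: ft y_def)
  then show "2 * (?z' \<bullet> (P *v ?z t)) + (\<Sum>i\<in>UNIV. S i)
      \<le> qform (2 *\<^sub>R sym_part (transpose (G2 A Z) ** P ** G1 \<tau>)
            + M1 \<Theta> + M2 A Z \<tau> \<Gamma> \<Omega> + M3 \<tau> \<Gamma> \<Omega> + M4 \<Gamma>) \<xi>"
    by (simp add: qform_add qform_sym_part) (simp add: \<xi>_def G1_mult G2_mult tw ft y_def)
  have "(norm (hist \<tau> x t))\<^sup>2 \<le> (norm \<xi>)\<^sup>2"
    unfolding \<xi>_def hist_def y_def[symmetric] dot_square_norm[symmetric] inner_vjoin by simp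
  then show "norm (hist \<tau> x t) \<le> norm \<xi>"
    by (simp add: power2_le_iff_abs_le)
qed

text \<open>All window terms are nonnegative, and coercivity of \<open>P\<close> controls the first
  block of z.\<close>

lemma lyap_lower:
  fixes \<tau> :: "'q::finite \<Rightarrow> real"
  assumes x: "continuous_on {a..} x" and f: "continuous_on {a..} f"
    and \<tau>: "\<And>i. 0 < \<tau> i" "\<And>i. a < t - \<tau> i"
    and psd: "\<And>i. pos_semidef (\<Theta> i)" "\<And>i. pos_semidef (\<Gamma> i)" "\<And>i. pos_semidef (\<Omega> i)"
    and P: "0 \<le> l" "\<And>v. l * (norm v)\<^sup>2 \<le> qform P v"
  shows "l * (norm (x t))\<^sup>2 \<le> lyap P \<tau> \<Theta> \<Gamma> \<Omega> a x f t"
proof -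
  have "l * (norm (x t))\<^sup>2 \<le> l * (norm (vjoin (x t) (vflat (\<lambda>i. win (\<tau> i) a x t))))\<^sup>2"
    using P(1) by (intro mult_left_mono) (simp_all add: inner_vjoin flip: dot_square_norm)
  also have "\<dots> \<le> qform P (vjoin (x t) (vflat (\<lambda>i. win (\<tau> i) a x t)))"
    by (rule P)
  also have "\<dots> \<le> lyap P \<tau> \<Theta> \<Gamma> \<Omega> a x f t"
    unfolding lyap_def using \<tau> psd
    by (intro le_add_same_cancel1[THEN iffD2] sum_nonneg add_nonneg_nonneg mult_nonneg_nonneg
        win_nonneg dwin_bounds continuous_on_qform x f pos_semidef_qform) (auto intro: less_imp_le)
  finally show ?thesis .
qed

text \<open>\<open>C\<close> is chosen before the trajectory, the base point and the time, so it is
  uniform over all solutions. The majorant \<open>g\<close> will be \<eta>, which controls both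
  \<open>x\<close> and its derivative.\<close>

lemma lyap_upper:
  fixes \<tau> :: "'q::finite \<Rightarrow> real" and \<Theta> \<Gamma> \<Omega> :: "'q \<Rightarrow> real^'n^'n"
  assumes \<tau>: "\<And>i. 0 < \<tau> i" "\<And>i. \<tau> i \<le> h" and k: "0 < k"
    and psd: "\<And>i. pos_semidef (\<Theta> i)" "\<And>i. pos_semidef (\<Gamma> i)" "\<And>i. pos_semidef (\<Omega> i)"
  shows "\<exists>C>0. \<forall>x f g a t. continuous_on {a..} x \<longrightarrow> continuous_on {a..} f \<longrightarrow> continuous_on {a..} g \<longrightarrow> a < t - h \<longrightarrow>
      (\<forall>s\<ge>a. (norm (x s))\<^sup>2 \<le> g s \<and> (norm (f s))\<^sup>2 \<le> k * g s)
      \<longrightarrow> lyap P \<tau> \<Theta> \<Gamma> \<Omega> a x f t \<le> C * ((norm (x t))\<^sup>2 + win h a g t)"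
proof -
  obtain cP where cP: "cP > 0" "\<And>v. qform P v \<le> cP * (norm v)\<^sup>2"
    using qform_le by metis
  obtain cT cG cO where c: "cT > 0" "\<And>i v. qform (\<Theta> i) v \<le> cT * (norm v)\<^sup>2"
    "cG > 0" "\<And>i v. qform (\<Gamma> i) v \<le> cG * (norm v)\<^sup>2"
    "cO > 0" "\<And>i v. qform (\<Omega> i) v \<le> cO * (norm v)\<^sup>2"
    using qform_le_family by metis
  define q where "q = real CARD('q)"
  have h: "0 < h" using \<tau>[of undefined] by simp
  \<comment> \<open>The first summand pays for z^T P z, the second for the \<Theta>-, \<Gamma>- and
    \<Omega>-terms of all \<open>q\<close> delays. Each weighted integral costs two factors
    \<open>h\<close>: the delay in front and the bound on the weight.\<close>
  define C where "C = cP * (1 + q * h) + q * (cT + h * (h * (cG * k)) + h * (h * cO))"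
  have q: "0 \<le> q" by (simp add: q_def)
  show ?thesis
  proof (intro exI[of _ C] conjI allI impI)
    have "0 < cP * (1 + q * h)"
      using cP(1) h q by (intro mult_pos_pos add_pos_nonneg) auto
    moreover have "0 \<le> q * (cT + h * (h * (cG * k)) + h * (h * cO))"
      using c(1,3,5) h k q by (intro mult_nonneg_nonneg add_nonneg_nonneg) auto
    ultimately show "C > 0" by (simp add: C_def)
    fix x f :: "real \<Rightarrow> real^'n" and g :: "real \<Rightarrow> real" and a t :: real
    assume x: "continuous_on {a..} x" and f: "continuous_on {a..} f" and g: "continuous_on {a..} g"
      and t: "a < t - h" and "\<forall>s\<ge>a. (norm (x s))\<^sup>2 \<le> g s \<and> (norm (f s))\<^sup>2 \<le> k * g s"
    then have xg: "(norm (x s))\<^sup>2 \<le> g s" and fg: "(norm (f s))\<^sup>2 \<le> k * g s" if "a \<le> s" for s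
      using that by blast+
    have ti: "a < t - \<tau> i" "0 \<le> \<tau> i" for i
      using t \<tau>(2)[of i] less_imp_le[OF \<tau>(1)[of i]] by auto
    have g0: "0 \<le> g s" if "a \<le> s" for s
      using xg[OF that] by (meson order_trans zero_le_power2)
    define w where "w = win h a g t"
    have w0: "0 \<le> w" unfolding w_def using g h t g0 by (intro win_nonneg) auto
    have bound: "win (\<tau> i) a u t \<le> c * w"
      if "continuous_on {a..} u" "0 \<le> c" "\<And>s. a \<le> s \<Longrightarrow> u s \<le> c * g s" for u c i
    proof -
      have "win (\<tau> i) a u t \<le> win (\<tau> i) a (\<lambda>s. c * g s) t"
        using that g ti[of i] by (intro win_mono continuous_intros) auto
      also have "\<dots> = c * win (\<tau> i) a g t" by (rule win_cmult)
      also have "\<dots> \<le> c * w"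
        unfolding w_def using that(2) ti[of i] \<tau>(2)[of i] t g g0 by (intro mult_left_mono win_mono_length) auto
      finally show ?thesis .
    qed
    have dbound: "\<tau> i * dwin (\<tau> i) a u t \<le> h * (h * c) * w"
      if "continuous_on {a..} u" "0 \<le> c" "\<And>s. a \<le> s \<Longrightarrow> u s \<le> c * g s" "\<And>s. a \<le> s \<Longrightarrow> 0 \<le> u s" for u c i
    proof -
      have "0 \<le> win (\<tau> i) a u t" using that ti[of i] by (intro win_nonneg) auto
      have "dwin (\<tau> i) a u t \<le> \<tau> i * win (\<tau> i) a u t"
        using that ti[of i] by (intro dwin_bounds) auto
      also have "\<dots> \<le> h * (c * w)"
        using bound[OF that(1-3)] \<tau>(2)[of i] h \<open>0 \<le> win (\<tau> i) a u t\<close> by (intro mult_mono) auto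
      finally have "\<tau> i * dwin (\<tau> i) a u t \<le> h * (h * (c * w))"
        using that ti[of i] \<tau>(2)[of i] h by (intro mult_mono dwin_bounds) auto
      then show ?thesis by (simp add: mult_ac)
    qed
    have xn: "continuous_on {a..} (\<lambda>s. (norm (x s))\<^sup>2)"
      using x by (intro continuous_intros)
    have "(norm (win (\<tau> i) a x t))\<^sup>2 \<le> h * w" for i
    proof -
      \<comment> \<open>For the identity matrix, Jensen's inequality bounds the squared norm of the
        window integral of \<open>x\<close>.\<close>
      have "pos_semidef (mat 1 :: real^'n^'n)" by (simp add: pos_semidef_def transpose_mat)
      from jensen_win[OF this x \<tau>(1)[of i] ti(1)]
      have "(norm (win (\<tau> i) a x t))\<^sup>2 \<le> \<tau> i * win (\<tau> i) a (\<lambda>s. (norm (x s))\<^sup>2) t"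
        by (simp add: qform_def dot_square_norm)
      also have "\<dots> \<le> h * w"
        using bound[OF xn, of 1 i] xg \<tau>(2)[of i] h xn ti[of i] by (intro mult_mono win_nonneg) auto
      finally show ?thesis .
    qed
    then have "(\<Sum>i\<in>UNIV. (norm (win (\<tau> i) a x t))\<^sup>2) \<le> q * (h * w)"
      unfolding q_def by (intro sum_bounded_above)
    then have "cP * (norm (vjoin (x t) (vflat (\<lambda>i. win (\<tau> i) a x t))))\<^sup>2 \<le> cP * ((norm (x t))\<^sup>2 + q * (h * w))"
      using cP(1) by (intro mult_left_mono) (simp_all add: inner_vjoin inner_vflat flip: dot_square_norm)
    note order_trans[OF cP(2) this]
    moreover have "(\<Sum>i\<in>UNIV. win (\<tau> i) a (\<lambda>s. qform (\<Theta> i) (x s)) t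
        + \<tau> i * dwin (\<tau> i) a (\<lambda>s. qform (\<Gamma> i) (f s)) t
        + \<tau> i * dwin (\<tau> i) a (\<lambda>s. qform (\<Omega> i) (x s)) t)
      \<le> q * (cT * w + h * (h * (cG * k)) * w + h * (h * cO) * w)"
      unfolding q_def
    proof (intro sum_bounded_above add_mono bound dbound continuous_on_qform x f pos_semidef_qform psd)
      fix i s assume s: "a \<le> s"
      show "qform (\<Theta> i) (x s) \<le> cT * g s"
        using c(1) xg[OF s] by (intro order_trans[OF c(2)] mult_left_mono) auto
      show "qform (\<Gamma> i) (f s) \<le> cG * k * g s"
        using c(3) fg[OF s] by (auto intro!: order_trans[OF c(4)] mult_left_mono simp: mult.assoc)
      show "qform (\<Omega> i) (x s) \<le> cO * g s"
        using c(5) xg[OF s] by (intro order_trans[OF c(6)] mult_left_mono) auto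
    qed (use c k in auto)
    ultimately have "lyap P \<tau> \<Theta> \<Gamma> \<Omega> a x f t
        \<le> cP * ((norm (x t))\<^sup>2 + q * (h * w)) + q * (cT * w + h * (h * (cG * k)) * w + h * (h * cO) * w)"
      unfolding lyap_def by (rule add_mono)
    also have "\<dots> = C * ((norm (x t))\<^sup>2 + w) - (C - cP) * (norm (x t))\<^sup>2 - cP * w"
      by (simp add: C_def algebra_simps)
    also have "\<dots> \<le> C * ((norm (x t))\<^sup>2 + w)"
    proof -
      have "0 \<le> C - cP"
        using c(1,3,5) cP(1) h k q unfolding C_def by (simp add: distrib_left)
      then have "0 \<le> (C - cP) * (norm (x t))\<^sup>2" by simp
      moreover have "0 \<le> cP * w" using cP(1) w0 by simp
      ultimately show ?thesis by linarith
    qed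
    finally show "lyap P \<tau> \<Theta> \<Gamma> \<Omega> a x f t \<le> C * ((norm (x t))\<^sup>2 + win h a g t)"
      by (simp add: w_def)
  qed
qed

section \<open>Growth of solutions and exponential decay\<close>

lemma delay_le_max_delay:
  assumes "mono \<tau>"
  shows "\<tau> i \<le> max_delay \<tau>"
  unfolding max_delay_def by (intro monoD[OF assms] Max_ge) auto

text \<open>Let \<open>m\<close> be the maximum of \<open>norm (x s) * exp (- K * s)\<close> on
  \<open>{0..t}\<close>, attained at \<open>r\<close>. If \<open>m\<close> exceeded
  \<open>N\<close>, the derivative bound would allow a displacement of at most
  \<open>m * (exp (K * r) - 1)\<close> from time 0 to \<open>r\<close>, so \<open>norm (x 0)\<close>
  would be at least \<open>m\<close>, contradicting the bound \<open>N\<close> on the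
  history.\<close>

lemma delay_growth:
  fixes x f :: "real \<Rightarrow> 'a::real_normed_vector"
  assumes \<tau>: "\<And>i. 0 \<le> \<tau> i" "\<And>i. \<tau> i \<le> h" and K: "0 \<le> K" "0 \<le> h"
    and x': "\<And>t. 0 \<le> t \<Longrightarrow> (x has_vector_derivative f t) (at t within {0..})"
    and f: "\<And>t m. \<lbrakk>0 \<le> t; norm (x t) \<le> m; \<And>i. norm (x (t - \<tau> i)) \<le> m\<rbrakk> \<Longrightarrow> norm (f t) \<le> K * m"
    and N: "\<And>s. - h \<le> s \<Longrightarrow> s \<le> 0 \<Longrightarrow> norm (x s) \<le> N" and t: "0 \<le> t"
  shows "norm (x t) \<le> N * exp (K * t)"
proof -
  have cont: "continuous_on {0..} x"
    using x' by (auto simp: continuous_on_eq_continuous_within intro: has_vector_derivative_continuous)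
  have "continuous_on {0..t} (\<lambda>s. norm (x s) * exp (- K * s))"
    by (intro continuous_intros continuous_on_subset[OF cont]) auto
  then obtain r where r: "r \<in> {0..t}"
      "\<And>s. s \<in> {0..t} \<Longrightarrow> norm (x s) * exp (- K * s) \<le> norm (x r) * exp (- K * r)"
    using continuous_attains_sup[of "{0..t}"] t by fastforce
  define m where "m = norm (x r) * exp (- K * r)"
  have m: "norm (x s) \<le> m * exp (K * s)" if "0 \<le> s" "s \<le> t" for s
    using r(2)[of s] that by (simp add: m_def exp_minus divide_simps)
  have N0: "norm (x 0) \<le> N" using N[of 0] K by simp
  have "m \<le> N"
  proof (rule ccontr)
    assume "\<not> m \<le> N"
    then have mN: "N < m" and m0: "0 \<le> m" by (simp_all add: m_def)
    have "r \<noteq> 0"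
    proof
      assume "r = 0"
      with mN N0 show False by (simp add: m_def)
    qed
    with r(1) have r0: "0 < r" by simp
    \<comment> \<open>Mean value inequality: \<open>norm (f s)\<close> is bounded by the derivative
      of \<open>m * exp (K * s)\<close>.\<close>
    have "norm (x r - x 0) \<le> m * exp (K * r) - m * exp (K * 0)"
    proof (rule differentiable_bound_general[OF r0])
      show "continuous_on {0..r} x" by (rule continuous_on_subset[OF cont]) auto
      show "continuous_on {0..r} (\<lambda>s. m * exp (K * s))" by (intro continuous_intros)
      fix s assume s: "0 < s" "s < r"
      have "at s within {0..} = at s" using s by (intro at_within_interior) auto
      with x'[of s] s show "(x has_vector_derivative f s) (at s)" by simp
      show "((\<lambda>s. m * exp (K * s)) has_vector_derivative K * (m * exp (K * s))) (at s)"
        unfolding has_real_derivative_iff_has_vector_derivative[symmetric]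
        by (auto intro!: derivative_eq_intros)
      show "norm (f s) \<le> K * (m * exp (K * s))"
      proof (rule f)
        show "norm (x s) \<le> m * exp (K * s)" using s r(1) by (intro m) auto
        fix i
        show "norm (x (s - \<tau> i)) \<le> m * exp (K * s)"
        proof (cases "0 \<le> s - \<tau> i")
          case True
          then have "norm (x (s - \<tau> i)) \<le> m * exp (K * (s - \<tau> i))"
            using s r(1) \<tau>(1)[of i] by (intro m) auto
          also have "\<dots> \<le> m * exp (K * s)"
            using m0 K \<tau>(1)[of i] by (intro mult_left_mono) (auto intro: mult_left_mono)
          finally show ?thesis .
        next
          case False
          \<comment> \<open>The delayed time falls into the history, where \<open>N < m\<close>
            applies.\<close>
          then have "norm (x (s - \<tau> i)) \<le> m * 1"
            using N[of "s - \<tau> i"] \<tau>(2)[of i] s mN by simp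
          also have "\<dots> \<le> m * exp (K * s)"
            using m0 K s by (intro mult_left_mono) auto
          finally show ?thesis .
        qed
      qed (use s in auto)
    qed
    moreover have "norm (x r) = m * exp (K * r)"
      by (simp add: m_def exp_minus)
    ultimately have "m \<le> norm (x 0)"
      using norm_triangle_ineq2[of "x r" "x 0"] by simp
    with N0 mN show False by simp
  qed
  then show ?thesis
    using m[of t] t by (meson exp_ge_zero mult_right_mono order_refl order_trans)
qed

text \<open>The product \<open>W s * exp (b * s)\<close> is nonincreasing; no sign of
  \<open>W\<close> enters.\<close>

lemma exp_decay:
  fixes W :: "real \<Rightarrow> real"
  assumes "T \<le> t" and W: "\<And>s. T \<le> s \<Longrightarrow> \<exists>D. (W has_real_derivative D) (at s) \<and> D \<le> - b * W s"
  shows "W t \<le> exp (- b * (t - T)) * W T"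
proof -
  have "W t * exp (b * t) \<le> W T * exp (b * T)"
  proof (rule DERIV_nonpos_imp_nonincreasing[OF assms(1)])
    fix s assume "T \<le> s"
    then obtain D where D: "(W has_real_derivative D) (at s)" "D \<le> - b * W s"
      using W by blast
    have "((\<lambda>s. W s * exp (b * s)) has_real_derivative (D + b * W s) * exp (b * s)) (at s)"
      by (auto intro!: derivative_eq_intros D(1) simp: algebra_simps)
    moreover have "(D + b * W s) * exp (b * s) \<le> 0"
      using D(2) by (simp add: mult_le_0_iff)
    ultimately show "\<exists>y. ((\<lambda>s. W s * exp (b * s)) has_real_derivative y) (at s) \<and> y \<le> 0"
      by blast
  qed
  then show ?thesis
    by (simp add: algebra_simps exp_diff exp_minus divide_simps)
qed

section \<open>Exponential stability from the matrix inequality\<close>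

theorem proposition3p4:
  fixes \<tau> :: "'q::{finite,linorder} \<Rightarrow> real"
    and J R A :: "real^'n^'n"
    and Z \<Theta> \<Gamma> \<Omega> :: "'q \<Rightarrow> real^'n^'n"
    and P :: "real^('n + 'q \<times> 'n)^('n + 'q \<times> 'n)"
  assumes "\<And>i. 0 < \<tau> i" and "mono \<tau>"
    and "J = - transpose J" and "pos_semidef R" and "A = J - R"
    and "pos_def P"
    and "\<And>i. pos_semidef (\<Theta> i)" and "\<And>i. pos_semidef (\<Gamma> i)" and "\<And>i. pos_semidef (\<Omega> i)"
    and "neg_def (2 *\<^sub>R sym_part (transpose (G2 A Z) ** P ** G1 \<tau>)
            + M1 \<Theta> + M2 A Z \<tau> \<Gamma> \<Omega> + M3 \<tau> \<Gamma> \<Omega> + M4 \<Gamma>)"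
  shows "globally_exp_stable A Z \<tau>"
proof -
  note \<tau> = assms(1) and psd = assms(7-9)
  define M where "M = 2 *\<^sub>R sym_part (transpose (G2 A Z) ** P ** G1 \<tau>)
            + M1 \<Theta> + M2 A Z \<tau> \<Gamma> \<Omega> + M3 \<tau> \<Gamma> \<Omega> + M4 \<Gamma>"
  define h where "h = max_delay \<tau>"
  \<comment> \<open>The number of blocks of \<open>hist\<close>: the present value and one for each
    delay.\<close>
  define q where "q = real CARD('q) + 1"
  have \<tau>h: "\<tau> i \<le> h" for i
    unfolding h_def by (rule delay_le_max_delay[OF assms(2)])
  have h: "0 < h" using less_le_trans[OF \<tau> \<tau>h] .
  have q: "1 \<le> q" by (simp add: q_def)
  have P: "transpose P = P" using assms(6) by (simp add: pos_def_def)
  obtain l where l: "l > 0" "\<And>v. l * (norm v)\<^sup>2 \<le> qform P v"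
    using qform_coercive[of P] assms(6) by (metis pos_def_def qform_def)
  have qM: "qform (- M) v = - qform M v" for v
    by (simp add: qform_def minus_matrix_mult)
  have "0 < qform (- M) v" if "v \<noteq> 0" for v
    using assms(10) that unfolding qM M_def[symmetric] by (simp add: neg_def_def qform_def)
  then obtain e where e: "e > 0" "\<And>v. e * (norm v)\<^sup>2 \<le> - qform M v"
    using qform_coercive[of "- M"] unfolding qM by blast
  \<comment> \<open>The right-hand side of the system is this row matrix applied to
    \<open>hist\<close>, so \<open>B\<close> bounds x' by \<open>hist\<close>.\<close>
  obtain B where B: "B > 0" "\<And>v. norm ((A ||| block_row Z) *v v) \<le> norm v * B"
    using bounded_linear.pos_bounded[OF matrix_vector_mul_bounded_linear[of "A ||| block_row Z"]] by blast
  obtain C where C: "C > 0"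
    "\<forall>x f g a t. continuous_on {a..} x \<longrightarrow> continuous_on {a..} f \<longrightarrow> continuous_on {a..} g \<longrightarrow> a < t - h \<longrightarrow>
      (\<forall>s\<ge>a. (norm (x s))\<^sup>2 \<le> g s \<and> (norm (f s))\<^sup>2 \<le> B\<^sup>2 * g s)
      \<longrightarrow> lyap P \<tau> \<Theta> \<Gamma> \<Omega> a x f t \<le> C * ((norm (x t))\<^sup>2 + win h a g t)"
    using lyap_upper[where \<tau> = \<tau> and h = h and k = "B\<^sup>2" and P = P and \<Theta> = \<Theta> and \<Gamma> = \<Gamma> and \<Omega> = \<Omega>]
      \<tau> \<tau>h zero_less_power[OF B(1)] psd by blast
  define K where "K = B * sqrt q"
  \<comment> \<open>The added term \<open>d * dwin h h g\<close> has derivative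
    \<open>d * (h * g - w)\<close>. The choice \<open>d * h = e / 2\<close> spends half of the
    available decay \<open>e * g\<close> and gains \<open>- d * w\<close>.\<close>
  define d where "d = e / (2 * h)"
  \<comment> \<open>Here W \<le> (C + e/2) (g + w) and W' \<le> - min(e/2, d) (g + w), so W decays
    at rate \<open>2 * b\<close>. The extra factor 2 is there because W is quadratic in
    \<open>x\<close>.\<close>
  define b where "b = min (e / 2) d / (2 * (C + e / 2))"
  \<comment> \<open>The primitives start at \<open>h\<close>, and a window of length
    \<open>h\<close> must begin strictly after that, which holds from \<open>3 * h\<close>
    on.\<close>
  define T where "T = 3 * h"
  define L where "L = exp (K * T)"
  define S where "S = (C + e / 2) * (1 + h) * q * L\<^sup>2"
  \<comment> \<open>The second summand serves times before \<open>T\<close>, the third those from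
    \<open>T\<close> on; the 1 secures \<open>c \<ge> 1\<close>.\<close>
  define c where "c = 1 + L * exp (b * T) + sqrt (S / l) * exp (b * T)"
  have K: "0 \<le> K" using B(1) q by (simp add: K_def)
  have d: "0 < d" "d * h = e / 2" using e(1) h by (simp_all add: d_def)
  have b: "0 < b" using e(1) d C(1) by (simp add: b_def)
  have bC: "2 * b * (C + e / 2) = min (e / 2) d"
  proof -
    have "2 * C + e \<noteq> 0" using e(1) C(1) by linarith
    then show ?thesis unfolding b_def by (simp add: field_simps)
  qed
  have S: "0 \<le> S" using C(1) e(1) h q by (simp add: S_def)
  have c: "1 \<le> c" using S l(1) by (simp add: c_def L_def)
  have "norm (x t) \<le> c * exp (- b * t) * (SUP s\<in>{- h..0}. norm (\<phi> s))"
    if \<phi>: "continuous_on {- h..0} \<phi>" and sol: "delay_solution A Z \<tau> \<phi> x" and t: "0 \<le> t" for \<phi> x t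
  proof -
    define N where "N = (SUP s\<in>{- h..0}. norm (\<phi> s))"
    define f where "f t = A *v x t + (\<Sum>i\<in>UNIV. Z i *v x (t - \<tau> i))" for t
    define g where "g t = (norm (hist \<tau> x t))\<^sup>2" for t
    define w where "w = win h h g"
    define W where "W t = lyap P \<tau> \<Theta> \<Gamma> \<Omega> h x f t + d * dwin h h g t" for t
    have x\<phi>: "x s = \<phi> s" if "- h \<le> s" "s \<le> 0" for s
      using sol that by (simp add: delay_solution_def h_def)
    have x': "(x has_vector_derivative f s) (at s within {0..})" if "0 \<le> s" for s
      using sol that by (simp add: delay_solution_def f_def)
    have "bdd_above ((\<lambda>s. norm (\<phi> s)) ` {- h..0})"
      using \<phi> by (intro compact_imp_bounded[THEN bounded_imp_bdd_above] compact_continuous_image continuous_intros) auto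
    then have N: "norm (x s) \<le> N" if "- h \<le> s" "s \<le> 0" for s
      unfolding N_def x\<phi>[OF that] using that by (intro cSUP_upper) auto
    have N0: "0 \<le> N" using order_trans[OF norm_ge_zero N[of 0]] h by simp
    have f_hist: "f s = (A ||| block_row Z) *v hist \<tau> x s" for s
      by (simp add: f_def hist_def hcat_mult_vjoin block_row_mult_vflat)
    have g_le: "g s \<le> q * m\<^sup>2" if "norm (x s) \<le> m" "\<And>i. norm (x (s - \<tau> i)) \<le> m" for s m
    proof -
      have "(\<Sum>i\<in>UNIV. (norm (x (s - \<tau> i)))\<^sup>2) \<le> real CARD('q) * m\<^sup>2"
        using that(2) by (intro sum_bounded_above power_mono) auto
      moreover have "(norm (x s))\<^sup>2 \<le> m\<^sup>2"
        using that(1) by (intro power_mono) auto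
      ultimately show ?thesis by (simp add: g_def norm_hist q_def algebra_simps)
    qed
    have growth: "norm (x s) \<le> N * exp (K * s)" if "0 \<le> s" for s
    proof (rule delay_growth[where \<tau> = \<tau> and f = f and h = h])
      fix r m assume r: "norm (x r) \<le> m" "\<And>i. norm (x (r - \<tau> i)) \<le> m"
      then have "0 \<le> m" using order_trans[OF norm_ge_zero] by blast
      have "norm (hist \<tau> x r) \<le> sqrt q * m"
        using real_le_rsqrt[OF g_le[OF r, unfolded g_def]] \<open>0 \<le> m\<close> by (simp add: real_sqrt_mult)
      then have "norm (hist \<tau> x r) * B \<le> (sqrt q * m) * B"
        using B(1) by (intro mult_right_mono) auto
      with B(2)[of "hist \<tau> x r"] show "norm (f r) \<le> K * m"
        by (simp add: f_hist K_def mult_ac)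
    qed (use less_imp_le[OF \<tau>] \<tau>h K h x' N that in auto)
    have early: "norm (x s) \<le> L * N" if "- h \<le> s" "s \<le> T" for s
    proof (cases "0 \<le> s")
      case True
      then have "N * exp (K * s) \<le> N * L"
        unfolding L_def using that K N0 by (intro mult_left_mono) (auto intro: mult_left_mono)
      with growth[OF True] show ?thesis by (simp add: mult.commute)
    next
      case False
      have "1 * N \<le> L * N"
        using N0 K h by (intro mult_right_mono) (auto simp: L_def T_def)
      with N[of s] that False show ?thesis by simp
    qed
    have x_cont: "continuous_on {0..} x"
      using x' by (auto simp: continuous_on_eq_continuous_within intro: has_vector_derivative_continuous)
    have xh: "continuous_on {h..} x"
      using h by (intro continuous_on_subset[OF x_cont]) auto
    \<comment> \<open>From time \<open>h\<close> on every delayed argument is nonnegative, so the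
      history is no longer involved; hence the base point \<open>h\<close>.\<close>
    have xd: "continuous_on {h..} (\<lambda>s. x (s - \<tau> i))" for i
      using \<tau>h[of i] by (intro continuous_on_compose2[OF x_cont] continuous_intros) auto
    have fh: "continuous_on {h..} f"
      unfolding f_def[abs_def] using xh xd
      by (intro continuous_intros bounded_linear.continuous_on[OF matrix_vector_mul_bounded_linear]) auto
    have gh: "continuous_on {h..} g"
      unfolding g_def[abs_def] norm_hist using xh xd by (intro continuous_intros) auto
    have x'h: "(x has_vector_derivative f s) (at s)" if "h < s" for s
    proof -
      have "at s within {0..} = at s" using that h by (intro at_within_interior) auto
      with x'[of s] that h show ?thesis by simp
    qed
    have xg: "(norm (x s))\<^sup>2 \<le> g s" for s
      by (simp add: g_def norm_hist sum_nonneg)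
    have fg: "(norm (f s))\<^sup>2 \<le> B\<^sup>2 * g s" for s
      using power_mono[OF B(2)[of "hist \<tau> x s"], of 2] by (simp add: f_hist g_def power_mult_distrib mult.commute)
    have g0: "0 \<le> g s" for s by (simp add: g_def)
    have late: "h < s - \<tau> i" "h < s - h" if "T \<le> s" for s i
      using that \<tau>h[of i] h by (auto simp: T_def)
    have w0: "0 \<le> w s" if "T \<le> s" for s
      unfolding w_def using late[OF that] h gh g0 by (intro win_nonneg) auto
    have W_upper: "W s \<le> (C + e / 2) * (g s + w s)" if "T \<le> s" for s
    proof -
      have "lyap P \<tau> \<Theta> \<Gamma> \<Omega> h x f s \<le> C * ((norm (x s))\<^sup>2 + w s)"
        unfolding w_def by (intro C(2)[rule_format] conjI xh fh gh late that xg fg)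
      also have "\<dots> \<le> C * (g s + w s)"
        using C(1) xg by (intro mult_left_mono) auto
      finally have "lyap P \<tau> \<Theta> \<Gamma> \<Omega> h x f s \<le> C * (g s + w s)" .
      moreover have "dwin h h g s \<le> h * w s"
        unfolding w_def using late[OF that] h gh g0 by (intro dwin_bounds) auto
      then have "d * dwin h h g s \<le> d * (h * w s)"
        using d by (intro mult_left_mono) auto
      then have "d * dwin h h g s \<le> e / 2 * w s" by (simp flip: d(2) mult.assoc)
      moreover have "0 \<le> e / 2 * g s" using e(1) g0 by simp
      ultimately show ?thesis
        unfolding W_def distrib_left distrib_right by linarith
    qed
    have W_lower: "l * (norm (x s))\<^sup>2 \<le> W s" if "T \<le> s" for s
    proof -
      have "l * (norm (x s))\<^sup>2 \<le> lyap P \<tau> \<Theta> \<Gamma> \<Omega> h x f s"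
        using l by (intro lyap_lower xh fh \<tau> late that psd) auto
      moreover have "0 \<le> dwin h h g s"
        using late[OF that] h gh g0 by (intro dwin_bounds) auto
      ultimately show ?thesis using d(1) by (simp add: W_def add_increasing2)
    qed
    have W_deriv: "\<exists>D. (W has_real_derivative D) (at s) \<and> D \<le> - (2 * b) * W s" if "T \<le> s" for s
    proof -
      note late_s = late[OF that]
      obtain D \<xi> where D: "(lyap P \<tau> \<Theta> \<Gamma> \<Omega> h x f has_real_derivative D) (at s)"
        "norm (hist \<tau> x s) \<le> norm \<xi>" "D \<le> qform M \<xi>"
        unfolding M_def
        by (rule lyap_derivative[where a = h and x = x and f = f and t = s and \<tau> = \<tau> and P = P and \<Theta> = \<Theta>
              and \<Gamma> = \<Gamma> and \<Omega> = \<Omega> and A = A and Z = Z])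
          (use xh fh x'h \<tau> late_s P psd f_def in auto)
      have "e * g s \<le> e * (norm \<xi>)\<^sup>2"
        unfolding g_def using D(2) e(1) by (intro mult_left_mono power_mono) auto
      with e(2)[of \<xi>] D(3) have "D \<le> - e * g s" by simp
      moreover have "d * (h * g s) = e / 2 * g s" by (simp flip: d(2) mult.assoc)
      \<comment> \<open>Adding \<open>d * h * g = (e / 2) * g\<close> to the decay
        \<open>- e * g\<close> leaves a negative multiple of \<open>g\<close>, and now
        \<open>w\<close> occurs with a negative sign too.\<close>
      ultimately have "D + d * (h * g s - w s) \<le> - (e / 2 * g s + d * w s)"
        unfolding right_diff_distrib by linarith
      also have "2 * b * W s \<le> e / 2 * g s + d * w s"
      proof -
        have "2 * b * W s \<le> 2 * b * ((C + e / 2) * (g s + w s))"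
          using b W_upper[OF that] by (intro mult_left_mono) auto
        also have "\<dots> = min (e / 2) d * (g s + w s)"
          using bC by (simp flip: mult.assoc)
        also have "\<dots> \<le> e / 2 * g s + d * w s"
          unfolding distrib_left using g0 w0[OF that] by (intro add_mono mult_right_mono) auto
        finally show ?thesis .
      qed
      then have "- (e / 2 * g s + d * w s) \<le> - (2 * b) * W s" by simp
      finally have "D + d * (h * g s - w s) \<le> - (2 * b) * W s" .
      moreover have "(W has_real_derivative D + d * (h * g s - w s)) (at s)"
        unfolding W_def[abs_def] w_def using gh h late[OF that]
        by (intro DERIV_add D(1) DERIV_cmult dwin_real_derivative) auto
      ultimately show ?thesis by blast
    qed
    have W_init: "W T \<le> S * N\<^sup>2"
    proof -
      \<comment> \<open>On \<open>{h..T}\<close> the present and all delayed arguments lie where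
        \<open>early\<close> applies.\<close>
      have gL: "g s \<le> q * (L * N)\<^sup>2" if "h \<le> s" "s \<le> T" for s
      proof (intro g_le early)
        fix i
        show "- h \<le> s - \<tau> i" "s - \<tau> i \<le> T"
          using that h \<tau>h[of i] \<tau>[of i] by linarith+
      qed (use that h in auto)
      have "w T \<le> win h h (\<lambda>_. q * (L * N)\<^sup>2) T"
        unfolding w_def using gL gh h by (intro win_mono continuous_intros) (auto simp: T_def)
      also have "\<dots> = h * (q * (L * N)\<^sup>2)"
        using h by (intro win_const) (auto simp: T_def)
      finally have "g T + w T \<le> (1 + h) * (q * (L * N)\<^sup>2)"
        using gL[of T] h by (simp add: T_def algebra_simps)
      then have "(C + e / 2) * (g T + w T) \<le> (C + e / 2) * ((1 + h) * (q * (L * N)\<^sup>2))"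
        using C(1) e(1) by (intro mult_left_mono) auto
      with W_upper[of T] show ?thesis by (simp add: S_def power_mult_distrib mult_ac)
    qed
    have bT: "exp (b * T) * exp (- b * s) = exp (- b * (s - T))" for s
      by (simp add: algebra_simps flip: exp_add)
    have "norm (x t) \<le> c * exp (- b * t) * N"
    proof (cases "T \<le> t")
      case True
      have "l * (norm (x t))\<^sup>2 \<le> exp (- (2 * b) * (t - T)) * W T"
        using W_lower[OF True] exp_decay[OF True W_deriv] by simp
      also have "\<dots> \<le> exp (- (2 * b) * (t - T)) * (S * N\<^sup>2)"
        using W_init by (intro mult_left_mono) auto
      \<comment> \<open>The doubled rate is a square, so taking roots leaves the rate
        \<open>b\<close>.\<close>
      also have "exp (- (2 * b) * (t - T)) = (exp (- b * (t - T)))\<^sup>2"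
        by (simp add: power2_eq_square flip: exp_add)
      finally have "(norm (x t))\<^sup>2 \<le> S / l * (exp (- b * (t - T)) * N)\<^sup>2"
        using l(1) by (simp add: field_simps power_mult_distrib)
      from real_le_rsqrt[OF this]
      have "norm (x t) \<le> sqrt (S / l) * (exp (- b * (t - T)) * N)"
        using N0 by (simp only: real_sqrt_mult real_sqrt_abs abs_mult abs_exp_cancel abs_of_nonneg)
      also have "\<dots> = (sqrt (S / l) * exp (b * T)) * exp (- b * t) * N"
        unfolding bT[symmetric] by (simp only: mult.assoc)
      also have "\<dots> \<le> c * exp (- b * t) * N"
        using N0 by (intro mult_right_mono) (auto simp: c_def L_def)
      finally show ?thesis .
    next
      case False
      have "norm (x t) \<le> (L * N) * 1"
        using early[of t] False t h by simp
      \<comment> \<open>Before \<open>T\<close> the factor \<open>exp (- b * (t - T))\<close> is at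
        least 1, so the growth bound already has the required form.\<close>
      also have "\<dots> \<le> (L * N) * (exp (b * T) * exp (- b * t))"
        unfolding bT using False b N0 by (intro mult_left_mono) (auto simp: L_def mult_le_0_iff)
      also have "\<dots> = (L * exp (b * T)) * exp (- b * t) * N" by simp
      also have "\<dots> \<le> c * exp (- b * t) * N"
        using N0 S l(1) by (intro mult_right_mono) (auto simp: c_def)
      finally show ?thesis .
    qed
    then show ?thesis by (simp add: N_def)
  qed
  then show ?thesis
    unfolding globally_exp_stable_def h_def[symmetric] using b c by blast
qed

end
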